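(* Let $\mathcal P$ be a topological invariant of pairs which is a $\Sigma^0_2$ subset of $\mathcal K(Q)^2$ for the product of upper Vietoris topologies. If a pair $(X,A)$ is $\mathcal P$-minimal, then $\mathsf{SCT}_{(X,A)}$ is Weihrauch reducible to $\mathsf C_{\mathbb N}$.
   Context: $Q=[0,1]^{\mathbb N}$ is the Hilbert cube with metric $d_Q(x,y)=\sum_i2^{-i}|x_i-y_i|$. A pair $(X,A)$ is a compact metrizable $X$ with compact $A\subseteq X$; a copy in $Q$ is $(Y,B)$ with $Y\subseteq Q$ and a homeomorphism $X\to Y$ sending $A$ onto $B$. $\mathcal K(Q)$ is the set of compact subsets of $Q$; the upper Vietoris topology has basis $\{K:K\subseteq U\}$, $U$ ranging over finite unions of rational open balls (effectively numbered), and the Vietoris topology is generated by these and the sets $\{K:K\cap U\neq\emptyset\}$. A set is $\Pi^0_1$ if its complement is a union of a c.e. family of basic open sets; $\Sigma^0_2$ if it equals $\bigcup_n(\mathcal A_n\setminus\mathcal B_n)$ with $\mathcal A_n,\mathcal B_n$ uniformly $\Pi^0_1$. A property of pairs $\mathcal P\subseteq\mathcal K(Q)^2$ is a topological invariant if it contains every copy of each element. $(X',A')$ is a proper subpair of $(X,A)$ if $X'\subsetneq X$, $A'\subseteq A$; a pair is $\mathcal P$-minimal if it is in $\mathcal P$ and none of its proper subpairs is. $\mathsf{SCT}_{(X,A)}$ is the problem which takes a copy $(Y,B)$ of $(X,A)$ in $Q$, given as a point of $\mathcal K(Q)^2$ with the upper Vietoris topologies (i.e. via an enumeration of its basic neighborhoods),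 and outputs $Y$ as a point of $\mathcal K(Q)$ with the Vietoris topology. $\mathsf C_{\mathbb N}$ (closed choice on $\mathbb N$) takes an enumeration of the complement of a nonempty set $E\subseteq\mathbb N$ and outputs some element of $E$. Weihrauch reducibility $F\leq_W G$ means there are computable procedures converting any name of an input of $F$ into a name of an input of $G$ and converting any solution of that $G$-instance, together with the original name, into a solution of $F$. *)

theory Defs
  imports "HOL-Analysis.Analysis" "HOL-Library.Nat_Bijection"
begin

section \<open>Computability on Baire space\<close>

text \<open>
  Kleene's partial recursive functions, relative to a function \<open>p :: nat \<Rightarrow> nat\<close> that can be queried.
  Programs are not typed by arity: where the argument list has the wrong shape, there is no value.
\<close>

datatype prog =
    Zero
  | Succ
  | Proj nat
  | Query
  | Comp prog "prog list"
  | PrimRec prog prog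
  | Mu prog

inductive eval_prog :: "(nat \<Rightarrow> nat) \<Rightarrow> prog \<Rightarrow> nat list \<Rightarrow> nat \<Rightarrow> bool" for p :: "nat \<Rightarrow> nat" where
  zero: "eval_prog p Zero xs 0"
| succ: "eval_prog p Succ [x] (Suc x)"
| proj: "i < length xs \<Longrightarrow> eval_prog p (Proj i) xs (xs ! i)"
| query: "eval_prog p Query [x] (p x)"
| comp: "list_all2 (\<lambda>g y. eval_prog p g xs y) gs ys \<Longrightarrow> eval_prog p f ys z
    \<Longrightarrow> eval_prog p (Comp f gs) xs z"
| primrec_zero: "eval_prog p g xs y \<Longrightarrow> eval_prog p (PrimRec g h) (0 # xs) y"
| primrec_suc: "eval_prog p (PrimRec g h) (n # xs) r \<Longrightarrow> eval_prog p h (n # r # xs) y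
    \<Longrightarrow> eval_prog p (PrimRec g h) (Suc n # xs) y"
| mu: "eval_prog p f (n # xs) 0 \<Longrightarrow> (\<And>m. m < n \<Longrightarrow> \<exists>k. eval_prog p f (m # xs) (Suc k))
    \<Longrightarrow> eval_prog p (Mu f) xs n"

inductive_cases eval_prog_elims:
  "eval_prog p Zero xs y"
  "eval_prog p Succ xs y"
  "eval_prog p (Proj i) xs y"
  "eval_prog p Query xs y"
  "eval_prog p (Comp f gs) xs y"
  "eval_prog p (PrimRec g h) (0 # xs) y"
  "eval_prog p (PrimRec g h) (Suc n # xs) y"
  "eval_prog p (Mu f) xs y"

lemma eval_prog_unique: "eval_prog p e xs y \<Longrightarrow> eval_prog p e xs z \<Longrightarrow> y = z"
proof (induction arbitrary: z rule: eval_prog.induct)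
  case (comp xs gs ys f y z)
  obtain ys' where ys': "list_all2 (\<lambda>g y. eval_prog p g xs y) gs ys'" "eval_prog p f ys' z"
    using comp.prems by (rule eval_prog_elims(5))
  have len: "length ys = length ys'"
    using list_all2_lengthD[OF comp.IH(1)] list_all2_lengthD[OF ys'(1)] by simp
  have "ys ! i = ys' ! i" if "i < length ys" for i
    using list_all2_nthD2[OF comp.IH(1) that] list_all2_nthD2[OF ys'(1), of i] that len by simp
  then have "ys = ys'" using len by (simp add: nth_equalityI)
  then show ?case using comp.IH(2) ys'(2) by blast
next
  case (primrec_suc g h n xs r y z)
  from primrec_suc.prems obtain r' where
    "eval_prog p (PrimRec g h) (n # xs) r'" "eval_prog p h (n # r' # xs) z"
    by (rule eval_prog_elims(7))
  then show ?case using primrec_suc.IH by blast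
next
  case (mu f n xs z)
  from mu.prems have z: "eval_prog p f (z # xs) 0"
      "\<And>m. m < z \<Longrightarrow> \<exists>k. eval_prog p f (m # xs) (Suc k)"
    by (blast elim: eval_prog_elims(8))+
  show ?case
  proof (rule linorder_cases[of n z])
    assume "n < z"
    with z(2) mu.IH(1) show ?thesis by blast
  next
    assume "z < n"
    with z(1) mu.IH(2) show ?thesis by blast
  qed
qed (blast elim: eval_prog_elims)+

text \<open>\<open>transforms e p q\<close>: the type-2 procedure \<open>e\<close> converts the sequence \<open>p\<close> into the sequence \<open>q\<close>.\<close>

definition transforms :: "prog \<Rightarrow> (nat \<Rightarrow> nat) \<Rightarrow> (nat \<Rightarrow> nat) \<Rightarrow> bool" where
  "transforms e p q \<longleftrightarrow> (\<forall>n. eval_prog p e [n] (q n))"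

definition computable_fun :: "(nat \<Rightarrow> nat) \<Rightarrow> bool" where
  "computable_fun f \<longleftrightarrow> (\<exists>e. transforms e (\<lambda>_. 0) f)"

definition ce_set :: "nat set \<Rightarrow> bool" where
  "ce_set W \<longleftrightarrow> W = {} \<or> (\<exists>f. computable_fun f \<and> W = range f)"

definition join :: "(nat \<Rightarrow> nat) \<Rightarrow> (nat \<Rightarrow> nat) \<Rightarrow> nat \<Rightarrow> nat" where
  "join p q n = (if even n then p (n div 2) else q (n div 2))"

text \<open>
  The set enumerated by a sequence.  The value \<open>0\<close> means that nothing is enumerated at that stage,
  so that the empty set has enumerations as well.
\<close>

definition enumerated_by :: "(nat \<Rightarrow> nat) \<Rightarrow> nat set" where
  "enumerated_by p = {n. Suc n \<in> range p}"

section \<open>Weihrauch reducibility\<close>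

text \<open>
  A problem is a multivalued partial function between represented spaces; its domain consists of
  the instances that have a solution.
\<close>

record ('x, 'y) problem =
  inst_name :: "(nat \<Rightarrow> nat) \<Rightarrow> 'x \<Rightarrow> bool"
  sol_name :: "(nat \<Rightarrow> nat) \<Rightarrow> 'y \<Rightarrow> bool"
  solutions :: "'x \<Rightarrow> 'y set"

definition dom_names :: "('x, 'y) problem \<Rightarrow> (nat \<Rightarrow> nat) \<Rightarrow> 'x \<Rightarrow> bool" where
  "dom_names F p x \<longleftrightarrow> inst_name F p x \<and> solutions F x \<noteq> {}"

definition weihrauch_reducible :: "('x, 'y) problem \<Rightarrow> ('u, 'v) problem \<Rightarrow> bool"
    (infix "\<le>\<^sub>W" 50) where
  "F \<le>\<^sub>W G \<longleftrightarrow>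
    (\<exists>eK eH. \<forall>p x. dom_names F p x \<longrightarrow>
      (\<exists>k u. transforms eK p k \<and> dom_names G k u \<and>
        (\<forall>q v. v \<in> solutions G u \<and> sol_name G q v \<longrightarrow>
          (\<exists>h y. transforms eH (join p q) h \<and> sol_name F h y \<and> y \<in> solutions F x))))"

text \<open>An instance of closed choice is named by enumerating its complement.\<close>

definition closed_choice_nat :: "(nat set, nat) problem" where
  "closed_choice_nat =
    \<lparr> inst_name = (\<lambda>p E. enumerated_by p = - E),
      sol_name = (\<lambda>q n. q 0 = n),
      solutions = (\<lambda>E. E) \<rparr>"

section \<open>Spaces with a numbered basis\<close>

record 'x based_space =
  points :: "'x set"
  basic :: "nat \<Rightarrow> 'x set"

definition point_name :: "'x based_space \<Rightarrow> (nat \<Rightarrow> nat) \<Rightarrow> 'x \<Rightarrow> bool" where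
  "point_name S p x \<longleftrightarrow> x \<in> points S \<and> enumerated_by p = {n. x \<in> basic S n}"

definition prod_space :: "'x based_space \<Rightarrow> 'y based_space \<Rightarrow> ('x \<times> 'y) based_space" where
  "prod_space S T =
    \<lparr> points = points S \<times> points T,
      basic = (\<lambda>n. case prod_decode n of (i, j) \<Rightarrow> basic S i \<times> basic T j) \<rparr>"

text \<open>A sequence of sets that is uniformly \<open>\<Pi>\<^sup>0\<^sub>1\<close> (lightface).\<close>

definition uniformly_Pi01 :: "'x based_space \<Rightarrow> (nat \<Rightarrow> 'x set) \<Rightarrow> bool" where
  "uniformly_Pi01 S A \<longleftrightarrow>
    (\<exists>W. ce_set W \<and> (\<forall>n. A n = points S - (\<Union>k\<in>{k. prod_encode (n, k) \<in> W}. basic S k)))"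

definition Sigma02 :: "'x based_space \<Rightarrow> 'x set \<Rightarrow> bool" where
  "Sigma02 S P \<longleftrightarrow>
    (\<exists>A B. uniformly_Pi01 S A \<and> uniformly_Pi01 S B \<and> P = (\<Union>n. A n - B n))"

section \<open>The Hilbert cube and its hyperspaces\<close>

text \<open>
  The type \<open>nat \<Rightarrow> real\<close> carries the product topology; on the cube it is the topology of the
  metric \<open>dQ\<close> (lemma \<open>openin_hilbert_cube_iff\<close>), which differs from the library's \<open>dist\<close>.
\<close>

definition hilbert_cube :: "(nat \<Rightarrow> real) set" where
  "hilbert_cube = {x. \<forall>i. 0 \<le> x i \<and> x i \<le> 1}"

definition dQ :: "(nat \<Rightarrow> real) \<Rightarrow> (nat \<Rightarrow> real) \<Rightarrow> real" where
  "dQ x y = (\<Sum>i. (1 / 2) ^ i * \<bar>x i - y i\<bar>)"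

text \<open>Codes of the rationals in \<open>[0, 1]\<close>, and of the rational points of the cube with finite support.\<close>

definition unit_rat :: "nat \<Rightarrow> real" where
  "unit_rat n = (case prod_decode n of (a, b) \<Rightarrow> min 1 (real a / real (Suc b)))"

definition rational_point :: "nat \<Rightarrow> nat \<Rightarrow> real" where
  "rational_point n i =
    (let cs = list_decode n in if i < length cs then unit_rat (cs ! i) else 0)"

definition pos_rat :: "nat \<Rightarrow> real" where
  "pos_rat n = (case prod_decode n of (a, b) \<Rightarrow> real (Suc a) / real (Suc b))"

definition rational_ball :: "nat \<Rightarrow> (nat \<Rightarrow> real) set" where
  "rational_ball n =
    (case prod_decode n of (c, r) \<Rightarrow> {x \<in> hilbert_cube. dQ (rational_point c) x < pos_rat r})"

text \<open>\<open>set_decode e\<close> is the finite set with canonical index \<open>e\<close>.\<close>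

definition ball_union :: "nat \<Rightarrow> (nat \<Rightarrow> real) set" where
  "ball_union e = (\<Union>n\<in>set_decode e. rational_ball n)"

definition compacts_Q :: "(nat \<Rightarrow> real) set set" where
  "compacts_Q = {K. K \<subseteq> hilbert_cube \<and> compact K}"

definition upper_vietoris :: "(nat \<Rightarrow> real) set based_space" where
  "upper_vietoris =
    \<lparr> points = compacts_Q, basic = (\<lambda>e. {K \<in> compacts_Q. K \<subseteq> ball_union e}) \<rparr>"

definition vietoris_subbasic :: "nat \<Rightarrow> (nat \<Rightarrow> real) set set" where
  "vietoris_subbasic m =
    (case sum_decode m of
       Inl e \<Rightarrow> {K \<in> compacts_Q. K \<subseteq> ball_union e}
     | Inr e \<Rightarrow> {K \<in> compacts_Q. K \<inter> ball_union e \<noteq> {}})"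

text \<open>The basis consists of the finite intersections of subbasic sets.\<close>

definition vietoris :: "(nat \<Rightarrow> real) set based_space" where
  "vietoris =
    \<lparr> points = compacts_Q,
      basic = (\<lambda>n. {K \<in> compacts_Q. \<forall>m\<in>set_decode n. K \<in> vietoris_subbasic m}) \<rparr>"

section \<open>Pairs\<close>

definition compact_pair :: "'a topology \<Rightarrow> 'a set \<Rightarrow> bool" where
  "compact_pair X A \<longleftrightarrow> compact_space X \<and> metrizable_space X \<and> compactin X A"

definition is_copy ::
    "'a topology \<Rightarrow> 'a set \<Rightarrow> (nat \<Rightarrow> real) set \<Rightarrow> (nat \<Rightarrow> real) set \<Rightarrow> bool" where
  "is_copy X A Y B \<longleftrightarrow>
    Y \<subseteq> hilbert_cube \<and> (\<exists>f. homeomorphic_map X (top_of_set Y) f \<and> f ` A = B)"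

text \<open>
  Members \<open>(X, A)\<close> of \<open>P\<close> with \<open>\<not> A \<subseteq> X\<close> are not pairs and are left unconstrained.  This includes both
  the invariants that consist of pairs only and those that are \<open>\<Sigma>\<^sup>0\<^sub>2\<close> relative to the subspace of pairs.
\<close>

definition topological_invariant :: "((nat \<Rightarrow> real) set \<times> (nat \<Rightarrow> real) set) set \<Rightarrow> bool" where
  "topological_invariant P \<longleftrightarrow> P \<subseteq> compacts_Q \<times> compacts_Q \<and>
    (\<forall>(X, A)\<in>P. A \<subseteq> X \<longrightarrow> (\<forall>Y B. is_copy (top_of_set X) A Y B \<longrightarrow> (Y, B) \<in> P))"

text \<open>
  An abstract pair has an invariant when some copy of it in the cube belongs to \<open>P\<close>; by
  invariance, all its copies then do.
\<close>

definition has_property ::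
    "((nat \<Rightarrow> real) set \<times> (nat \<Rightarrow> real) set) set \<Rightarrow> 'a topology \<Rightarrow> 'a set \<Rightarrow> bool" where
  "has_property P X A \<longleftrightarrow> (\<exists>Y B. is_copy X A Y B \<and> (Y, B) \<in> P)"

definition proper_subpair :: "'a topology \<Rightarrow> 'a set \<Rightarrow> 'a set \<Rightarrow> 'a set \<Rightarrow> bool" where
  "proper_subpair X A X' A' \<longleftrightarrow>
    compactin X X' \<and> compactin X A' \<and> A' \<subseteq> X' \<and> X' \<subset> topspace X \<and> A' \<subseteq> A"

definition minimal_pair ::
    "((nat \<Rightarrow> real) set \<times> (nat \<Rightarrow> real) set) set \<Rightarrow> 'a topology \<Rightarrow> 'a set \<Rightarrow> bool" where
  "minimal_pair P X A \<longleftrightarrow> has_property P X A \<and>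
    (\<forall>X' A'. proper_subpair X A X' A' \<longrightarrow> \<not> has_property P (subtopology X X') A')"

definition SCT :: "'a topology \<Rightarrow> 'a set
    \<Rightarrow> ((nat \<Rightarrow> real) set \<times> (nat \<Rightarrow> real) set, (nat \<Rightarrow> real) set) problem" where
  "SCT X A =
    \<lparr> inst_name = point_name (prod_space upper_vietoris upper_vietoris),
      sol_name = point_name vietoris,
      solutions = (\<lambda>(Y, B). if is_copy X A Y B then {Y} else {}) \<rparr>"

section \<open>The metric and the topology of the cube\<close>

lemma summable_dQ:
  assumes "x \<in> hilbert_cube" "y \<in> hilbert_cube"
  shows "summable (\<lambda>i. (1 / 2) ^ i * \<bar>x i - y i\<bar>)"
proof (rule summable_comparison_test')
  show "summable (\<lambda>i. (1 / 2 :: real) ^ i)"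
    by (simp add: summable_geometric)
  fix i
  have "0 \<le> x i" "x i \<le> 1" "0 \<le> y i" "y i \<le> 1"
    using assms by (auto simp: hilbert_cube_def)
  then have "\<bar>x i - y i\<bar> \<le> 1" by linarith
  then show "norm ((1 / 2) ^ i * \<bar>x i - y i\<bar>) \<le> (1 / 2) ^ i"
    by (simp add: abs_mult mult_left_le)
qed

lemma continuous_on_dQ:
  assumes "x \<in> hilbert_cube"
  shows "continuous_on hilbert_cube (dQ x)"
proof -
  have "uniform_limit hilbert_cube (\<lambda>n y. \<Sum>i<n. (1 / 2) ^ i * \<bar>x i - y i\<bar>)
      (\<lambda>y. \<Sum>i. (1 / 2) ^ i * \<bar>x i - y i\<bar>) sequentially"
  proof (rule Weierstrass_m_test)
    show "summable (\<lambda>i. (1 / 2 :: real) ^ i)"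
      by (simp add: summable_geometric)
    fix i and y :: "nat \<Rightarrow> real" assume "y \<in> hilbert_cube"
    then have "0 \<le> x i" "x i \<le> 1" "0 \<le> y i" "y i \<le> 1"
      using assms by (auto simp: hilbert_cube_def)
    then have "\<bar>x i - y i\<bar> \<le> 1" by linarith
    then show "norm ((1 / 2) ^ i * \<bar>x i - y i\<bar>) \<le> (1 / 2) ^ i"
      by (simp add: abs_mult mult_left_le)
  qed
  then have "continuous_on hilbert_cube (\<lambda>y. \<Sum>i. (1 / 2) ^ i * \<bar>x i - y i\<bar>)"
  proof (rule uniform_limit_theorem[rotated])
    show "\<forall>\<^sub>F n in sequentially.
        continuous_on hilbert_cube (\<lambda>y. \<Sum>i<n. (1 / 2) ^ i * \<bar>x i - y i\<bar>)"
      by (intro always_eventually allI continuous_intros continuous_on_product_then_coordinatewise)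
         (auto intro: continuous_on_id)
  qed simp
  then show ?thesis
    by (simp add: dQ_def[abs_def])
qed

lemma coordinate_le_dQ:
  assumes "x \<in> hilbert_cube" "y \<in> hilbert_cube"
  shows "\<bar>x i - y i\<bar> \<le> 2 ^ i * dQ x y"
proof -
  have "(\<Sum>j\<in>{i}. (1 / 2) ^ j * \<bar>x j - y j\<bar>) \<le> dQ x y"
    unfolding dQ_def by (rule sum_le_suminf[OF summable_dQ[OF assms]]) auto
  then show ?thesis
    by (simp add: field_simps)
qed

lemma openin_hilbert_cube_iff:
  "openin (top_of_set hilbert_cube) U \<longleftrightarrow>
    U \<subseteq> hilbert_cube \<and> (\<forall>x\<in>U. \<exists>r>0. \<forall>y\<in>hilbert_cube. dQ x y < r \<longrightarrow> y \<in> U)"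
proof (intro iffI conjI ballI)
  assume "openin (top_of_set hilbert_cube) U"
  then obtain W where W: "open W" "U = hilbert_cube \<inter> W"
    by (auto simp: openin_open)
  then show "U \<subseteq> hilbert_cube" by auto
  fix x assume x: "x \<in> U"
  have "openin (product_topology (\<lambda>i. euclidean) UNIV) W"
    unfolding euclidean_product_topology using W(1) by simp
  moreover have "x \<in> W" using x W(2) by simp
  ultimately obtain V where V: "x \<in> Pi\<^sub>E UNIV V" "\<And>i. open (V i)"
      "finite {i. V i \<noteq> (UNIV :: real set)}" "Pi\<^sub>E UNIV V \<subseteq> W"
    using product_topology_open_contains_basis[of "\<lambda>i. euclidean" UNIV W x] by auto
  have "\<exists>e>0. \<forall>t. \<bar>x i - t\<bar> < e \<longrightarrow> t \<in> V i" for i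
  proof -
    have "x i \<in> V i" using V(1) by auto
    with V(2)[of i] obtain e where "e > 0" "\<forall>t. dist t (x i) < e \<longrightarrow> t \<in> V i"
      unfolding open_dist by blast
    then show ?thesis by (auto simp: dist_real_def abs_minus_commute)
  qed
  then obtain e where e: "\<And>i. e i > 0" "\<And>i t. \<bar>x i - t\<bar> < e i \<Longrightarrow> t \<in> V i"
    by metis
  define F where "F = {i. V i \<noteq> UNIV}"
  define r where "r = Min (insert 1 ((\<lambda>i. e i / 2 ^ i) ` F))"
  have finF: "finite F" using V(3) by (simp add: F_def)
  show "\<exists>r>0. \<forall>y\<in>hilbert_cube. dQ x y < r \<longrightarrow> y \<in> U"
  proof (intro exI conjI ballI impI)
    show "r > 0" using finF e(1) by (auto simp: r_def)
    fix y assume y: "y \<in> hilbert_cube" "dQ x y < r"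
    have "y i \<in> V i" for i
    proof (cases "i \<in> F")
      case True
      then have "r \<le> e i / 2 ^ i" using finF by (auto simp: r_def)
      then have "dQ x y < e i / 2 ^ i" using y(2) by linarith
      then have "2 ^ i * dQ x y < e i" by (simp add: field_simps)
      moreover have "x \<in> hilbert_cube" using x W by auto
      ultimately show ?thesis using coordinate_le_dQ[OF _ y(1), of x i] e(2)[of i "y i"] by auto
    qed (auto simp: F_def)
    then show "y \<in> U" using V(4) W y(1) by auto
  qed
next
  assume U: "U \<subseteq> hilbert_cube \<and> (\<forall>x\<in>U. \<exists>r>0. \<forall>y\<in>hilbert_cube. dQ x y < r \<longrightarrow> y \<in> U)"
  show "openin (top_of_set hilbert_cube) U"
  proof (subst openin_subopen, intro ballI)
    fix x assume x: "x \<in> U"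
    with U obtain r where r: "r > 0" "\<forall>y\<in>hilbert_cube. dQ x y < r \<longrightarrow> y \<in> U" by auto
    have xQ: "x \<in> hilbert_cube" using x U by auto
    have "openin (top_of_set hilbert_cube) (hilbert_cube \<inter> dQ x -` {..<r})"
      using continuous_on_dQ[OF xQ] by (intro continuous_openin_preimage_gen) auto
    moreover have "x \<in> hilbert_cube \<inter> dQ x -` {..<r}"
      using xQ r(1) by (simp add: dQ_def)
    ultimately show "\<exists>T. openin (top_of_set hilbert_cube) T \<and> x \<in> T \<and> T \<subseteq> U"
      using r(2) by (intro exI[of _ "hilbert_cube \<inter> dQ x -` {..<r}"]) auto
  qed
qed

end

theory Submission
  imports Defs
begin

text \<open>
  Write \<open>P = (\<Union>n. A\<^sub>n - B\<^sub>n)\<close> with uniformly \<open>\<Pi>\<^sup>0\<^sub>1\<close> sets.  A copy \<open>(Y, B)\<close> lies in \<open>P\<close>, and closed choice finds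
  some \<open>n\<close> with \<open>(Y, B) \<in> A\<^sub>n - B\<^sub>n\<close> together with a witness that \<open>(Y, B) \<notin> B\<^sub>n\<close>.  For open \<open>U\<close> the
  pair \<open>(Y - U, B - U)\<close> is outside \<open>B\<^sub>n\<close> as well, since upper Vietoris open sets are closed under
  shrinking.  If \<open>Y\<close> meets \<open>U\<close>, then by minimality this pair is not in \<open>P\<close>, hence not in \<open>A\<^sub>n\<close>; otherwise
  it equals \<open>(Y, B)\<close> and is in \<open>A\<^sub>n\<close>.  So \<open>Y\<close> meets \<open>U\<close> if and only if \<open>(Y - U, B - U) \<notin> A\<^sub>n\<close>, which is
  semidecidable because \<open>Y - U \<subseteq> V\<close> means \<open>Y \<subseteq> U \<union> V\<close>.
\<close>

section \<open>Programs\<close>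

definition computable_op :: "nat \<Rightarrow> ((nat \<Rightarrow> nat) \<Rightarrow> nat list \<Rightarrow> nat) \<Rightarrow> bool" where
  "computable_op k F \<longleftrightarrow> (\<exists>e. \<forall>p xs. length xs = k \<longrightarrow> eval_prog p e xs (F p xs))"

definition decidable_op :: "nat \<Rightarrow> ((nat \<Rightarrow> nat) \<Rightarrow> nat list \<Rightarrow> bool) \<Rightarrow> bool" where
  "decidable_op k R \<longleftrightarrow> computable_op k (\<lambda>p xs. of_bool (R p xs))"

lemma computable_opE:
  assumes "computable_op k F"
  obtains e where "\<And>p xs. length xs = k \<Longrightarrow> eval_prog p e xs (F p xs)"
  using assms unfolding computable_op_def by blast

lemma computable_opI:
  assumes "\<And>p xs. length xs = k \<Longrightarrow> eval_prog p e xs (F p xs)"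
  shows "computable_op k F"
  using assms unfolding computable_op_def by blast

lemma computable_op_cong:
  assumes "computable_op k F" "\<And>p xs. length xs = k \<Longrightarrow> F p xs = G p xs"
  shows "computable_op k G"
  using assms unfolding computable_op_def by metis

lemma computable_op_nth:
  assumes "i < k"
  shows "computable_op k (\<lambda>p xs. xs ! i)"
  by (rule computable_opI[where e = "Proj i"]) (use assms in \<open>auto intro: eval_prog.proj\<close>)

lemma computable_op_hd_drop:
  assumes "i < k"
  shows "computable_op k (\<lambda>p xs. hd (drop i xs))"
  by (rule computable_op_cong[OF computable_op_nth[OF assms]]) (use assms in \<open>simp add: hd_drop_conv_nth\<close>)

text \<open>
  The rules for recursion and quantifiers push the bound variables in front of the argument list,
  so variables appear as \<open>hd (tl (\<dots>))\<close> when the rules are applied backwards.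
\<close>

lemma computable_op_vars:
  "0 < k \<Longrightarrow> computable_op k (\<lambda>p xs. hd xs)"
  "1 < k \<Longrightarrow> computable_op k (\<lambda>p xs. hd (tl xs))"
  "2 < k \<Longrightarrow> computable_op k (\<lambda>p xs. hd (tl (tl xs)))"
  "3 < k \<Longrightarrow> computable_op k (\<lambda>p xs. hd (tl (tl (tl xs))))"
  "4 < k \<Longrightarrow> computable_op k (\<lambda>p xs. hd (tl (tl (tl (tl xs)))))"
  using computable_op_hd_drop[of 0 k] computable_op_hd_drop[of 1 k] computable_op_hd_drop[of 2 k]
    computable_op_hd_drop[of 3 k] computable_op_hd_drop[of 4 k]
  by (simp_all add: drop_Suc eval_nat_numeral)

section \<open>Closure under composition, recursion and search\<close>

lemma computable_op_comp:
  assumes F: "computable_op (length Gs) F" and Gs: "\<forall>G\<in>set Gs. computable_op k G"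
  shows "computable_op k (\<lambda>p xs. F p (map (\<lambda>G. G p xs) Gs))"
proof -
  obtain e where e: "\<And>p xs. length xs = length Gs \<Longrightarrow> eval_prog p e xs (F p xs)"
    using F by (rule computable_opE) blast
  have "\<forall>G\<in>set Gs. \<exists>g. \<forall>p xs. length xs = k \<longrightarrow> eval_prog p g xs (G p xs)"
    using Gs by (simp add: computable_op_def)
  then obtain g where g: "\<forall>G\<in>set Gs. \<forall>p xs. length xs = k \<longrightarrow> eval_prog p (g G) xs (G p xs)"
    by (auto dest: bchoice)
  show ?thesis
  proof (rule computable_opI[where e = "Comp e (map g Gs)"])
    fix p and xs :: "nat list" assume "length xs = k"
    then show "eval_prog p (Comp e (map g Gs)) xs (F p (map (\<lambda>G. G p xs) Gs))"
      using g by (intro eval_prog.comp[where ys = "map (\<lambda>G. G p xs) Gs"] e)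
        (auto simp: list_all2_map1 list_all2_map2 list_all2_same)
  qed
qed

lemma computable_op_subst1:
  assumes "computable_op 1 (\<lambda>p xs. f p (hd xs))" "computable_op k G"
  shows "computable_op k (\<lambda>p xs. f p (G p xs))"
  using computable_op_comp[of "[G]" "\<lambda>p xs. f p (hd xs)" k] assms by simp

lemma computable_op_subst2:
  assumes "computable_op 2 (\<lambda>p xs. f p (hd xs) (hd (tl xs)))" "computable_op k G" "computable_op k H"
  shows "computable_op k (\<lambda>p xs. f p (G p xs) (H p xs))"
  using computable_op_comp[of "[G, H]" "\<lambda>p xs. f p (hd xs) (hd (tl xs))" k] assms by (simp add: numeral_2_eq_2)

lemma computable_op_Suc:
  assumes "computable_op k G"
  shows "computable_op k (\<lambda>p xs. Suc (G p xs))"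
proof (rule computable_op_subst1[OF _ assms])
  show "computable_op 1 (\<lambda>p xs. Suc (hd xs))"
    by (rule computable_opI[where e = Succ]) (auto simp: length_Suc_conv intro: eval_prog.succ)
qed

lemma computable_op_oracle:
  assumes "computable_op k G"
  shows "computable_op k (\<lambda>p xs. p (G p xs))"
proof (rule computable_op_subst1[OF _ assms])
  show "computable_op 1 (\<lambda>p xs. p (hd xs))"
    by (rule computable_opI[where e = Query]) (auto simp: length_Suc_conv intro: eval_prog.query)
qed

lemma computable_op_const: "computable_op k (\<lambda>p xs. c)"
proof (induction c)
  case 0
  show ?case by (rule computable_opI[where e = Zero]) (rule eval_prog.zero)
qed (rule computable_op_Suc)

lemma computable_op_rec_nat:
  assumes G: "computable_op k G"
    and H: "computable_op (Suc (Suc k)) (\<lambda>p xs. H p (tl (tl xs)) (hd xs) (hd (tl xs)))"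
    and N: "computable_op k N"
  shows "computable_op k (\<lambda>p xs. rec_nat (G p xs) (\<lambda>n r. H p xs n r) (N p xs))"
proof -
  obtain g where g: "\<And>p xs. length xs = k \<Longrightarrow> eval_prog p g xs (G p xs)"
    using G by (rule computable_opE) blast
  obtain h where h: "\<And>p xs. length xs = Suc (Suc k) \<Longrightarrow>
      eval_prog p h xs (H p (tl (tl xs)) (hd xs) (hd (tl xs)))"
    using H by (rule computable_opE) blast
  have rec: "eval_prog p (PrimRec g h) (n # xs) (rec_nat (G p xs) (\<lambda>n r. H p xs n r) n)"
    if "length xs = k" for p n xs
  proof (induction n)
    case 0
    then show ?case by (simp add: eval_prog.primrec_zero g that)
  next
    case (Suc n)
    then show ?case
      using h[of "n # rec_nat (G p xs) (\<lambda>n r. H p xs n r) n # xs" p] that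
      by (auto intro: eval_prog.primrec_suc)
  qed
  have "computable_op (Suc k) (\<lambda>p xs. rec_nat (G p (tl xs)) (\<lambda>n r. H p (tl xs) n r) (hd xs))"
    by (rule computable_opI[where e = "PrimRec g h"]) (use rec in \<open>auto simp: length_Suc_conv\<close>)
  \<comment> \<open>\<open>PrimRec\<close> recurses on the head of its argument list. The bound
    \<open>N\<close> is put there by composition, and projections rebuild the parameters behind
    it.\<close>
  then have "computable_op k (\<lambda>p xs. (\<lambda>p xs. rec_nat (G p (tl xs)) (\<lambda>n r. H p (tl xs) n r) (hd xs)) p
      (map (\<lambda>G. G p xs) (N # map (\<lambda>i p xs. xs ! i) [0..<k])))"
    using N by (intro computable_op_comp) (auto intro: computable_op_nth)
  moreover have "map (\<lambda>i. xs ! i) [0..<k] = xs" if "length xs = k" for xs :: "nat list"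
    using that map_nth by blast
  ultimately show ?thesis
    by (elim computable_op_cong) (simp add: comp_def)
qed

lemma computable_op_Least:
  assumes R: "decidable_op (Suc k) (\<lambda>p xs. R p (tl xs) (hd xs))"
    and ex: "\<And>p xs. length xs = k \<Longrightarrow> \<exists>n. R p xs n"
  shows "computable_op k (\<lambda>p xs. LEAST n. R p xs n)"
proof -
  \<comment> \<open>\<open>Mu\<close> looks for a zero, but \<open>of_bool\<close> encodes truth as
    1. This recursion exchanges the two truth values.\<close>
  have "computable_op 1 (\<lambda>p xs. rec_nat 1 (\<lambda>n r. 0) (hd xs))"
    by (intro computable_op_rec_nat computable_op_const computable_op_vars) simp
  then have "computable_op (Suc k) (\<lambda>p xs. rec_nat 1 (\<lambda>n r. 0) (of_bool (R p (tl xs) (hd xs))))"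
    by (rule computable_op_subst1[where f = "\<lambda>_. rec_nat 1 (\<lambda>n r. 0)"])
      (use R in \<open>simp add: decidable_op_def\<close>)
  then obtain e where e: "\<And>p xs. length xs = Suc k \<Longrightarrow>
      eval_prog p e xs (rec_nat 1 (\<lambda>n r. 0) (of_bool (R p (tl xs) (hd xs))))"
    by (rule computable_opE) blast
  show ?thesis
  proof (rule computable_opI[where e = "Mu e"])
    fix p and xs :: "nat list" assume len: "length xs = k"
    define n where "n = (LEAST n. R p xs n)"
    have "R p xs n" unfolding n_def by (rule LeastI_ex[OF ex[OF len]])
    moreover have "\<not> R p xs m" if "m < n" for m
      using that not_less_Least unfolding n_def by blast
    ultimately have "eval_prog p e (n # xs) 0" "m < n \<Longrightarrow> eval_prog p e (m # xs) (Suc 0)" for m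
      using e[of "n # xs" p] e[of "m # xs" p] len by auto
    then show "eval_prog p (Mu e) xs n" by (blast intro: eval_prog.mu)
  qed
qed

section \<open>Arithmetic\<close>

lemma computable_op_add:
  assumes "computable_op k F" "computable_op k G"
  shows "computable_op k (\<lambda>p xs. F p xs + G p xs)"
proof (rule computable_op_subst2[OF _ assms])
  have "computable_op 2 (\<lambda>p xs. rec_nat (hd xs) (\<lambda>n r. Suc r) (hd (tl xs)))"
    by (intro computable_op_rec_nat computable_op_Suc computable_op_vars) simp_all
  moreover have "rec_nat a (\<lambda>n r. Suc r) b = a + b" for a b :: nat
    by (induction b) auto
  ultimately show "computable_op 2 (\<lambda>p xs. hd xs + hd (tl xs))" by simp
qed

lemma computable_op_mult:
  assumes "computable_op k F" "computable_op k G"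
  shows "computable_op k (\<lambda>p xs. F p xs * G p xs)"
proof (rule computable_op_subst2[OF _ assms])
  have "computable_op 2 (\<lambda>p xs. rec_nat 0 (\<lambda>n r. hd xs + r) (hd (tl xs)))"
    by (intro computable_op_rec_nat computable_op_add computable_op_const computable_op_vars) simp_all
  moreover have "rec_nat 0 (\<lambda>n r. a + r) b = a * b" for a b :: nat
    by (induction b) auto
  ultimately show "computable_op 2 (\<lambda>p xs. hd xs * hd (tl xs))" by simp
qed

lemma computable_op_diff:
  assumes "computable_op k F" "computable_op k G"
  shows "computable_op k (\<lambda>p xs. F p xs - G p xs)"
proof (rule computable_op_subst2[OF _ assms])
  \<comment> \<open>The predecessor comes from a recursion that returns its counter; iterating it
    gives truncated subtraction.\<close>
  have "computable_op 1 (\<lambda>p xs. rec_nat 0 (\<lambda>n r. n) (hd xs))"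
    by (intro computable_op_rec_nat computable_op_const computable_op_vars) simp_all
  then have pred: "computable_op k (\<lambda>p xs. F p xs - 1)" if "computable_op k F" for k F
  proof (intro computable_op_subst1[where f = "\<lambda>_ n. n - 1", OF _ that])
    have "rec_nat 0 (\<lambda>n r. n) a = a - 1" for a :: nat by (cases a) auto
    then show "computable_op 1 (\<lambda>p xs. rec_nat 0 (\<lambda>n r. n) (hd xs))
        \<Longrightarrow> computable_op 1 (\<lambda>p xs. hd xs - 1)" by simp
  qed
  have "computable_op 2 (\<lambda>p xs. rec_nat (hd xs) (\<lambda>n r. r - 1) (hd (tl xs)))"
    by (intro computable_op_rec_nat pred computable_op_vars) simp_all
  moreover have "rec_nat a (\<lambda>n r. r - 1) b = a - b" for a b :: nat
    by (induction b) auto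
  ultimately show "computable_op 2 (\<lambda>p xs. hd xs - hd (tl xs))" by simp
qed

lemma computable_op_power2:
  assumes "computable_op k F"
  shows "computable_op k (\<lambda>p xs. 2 ^ F p xs)"
proof (rule computable_op_subst1[OF _ assms])
  have "computable_op 1 (\<lambda>p xs. rec_nat 1 (\<lambda>n r. 2 * r) (hd xs))"
    by (intro computable_op_rec_nat computable_op_mult computable_op_const computable_op_vars) simp_all
  moreover have "rec_nat 1 (\<lambda>n r. 2 * r) b = (2 ^ b :: nat)" for b :: nat
    by (induction b) auto
  ultimately show "computable_op 1 (\<lambda>p xs. 2 ^ hd xs)" by simp
qed

lemma computable_op_prod_encode:
  assumes "computable_op k F" "computable_op k G"
  shows "computable_op k (\<lambda>p xs. prod_encode (F p xs, G p xs))"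
proof (rule computable_op_subst2[OF _ assms])
  \<comment> \<open>Cantor pairing is \<open>triangle (a + b) + a\<close>, with
    \<open>triangle\<close> unfolded into a recursion.\<close>
  have "computable_op 2 (\<lambda>p xs. rec_nat 0 (\<lambda>n r. r + Suc n) (hd xs + hd (tl xs)) + hd xs)"
    by (intro computable_op_rec_nat computable_op_add computable_op_Suc computable_op_const
        computable_op_vars) simp_all
  moreover have "rec_nat 0 (\<lambda>n r. r + Suc n) b = triangle b" for b :: nat
    by (induction b) auto
  ultimately show "computable_op 2 (\<lambda>p xs. prod_encode (hd xs, hd (tl xs)))"
    by (simp add: prod_encode_def)
qed

section \<open>Decidable predicates and bounded quantifiers\<close>

lemma decidable_op_le:
  assumes "computable_op k F" "computable_op k G"
  shows "decidable_op k (\<lambda>p xs. F p xs \<le> G p xs)"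
proof -
  have "computable_op k (\<lambda>p xs. 1 - (F p xs - G p xs))"
    by (intro computable_op_diff computable_op_const assms)
  moreover have "1 - (a - b) = of_bool (a \<le> b)" for a b :: nat by auto
  ultimately show ?thesis by (simp add: decidable_op_def)
qed

lemma decidable_op_conj:
  assumes "decidable_op k R" "decidable_op k S"
  shows "decidable_op k (\<lambda>p xs. R p xs \<and> S p xs)"
  using assms unfolding decidable_op_def of_bool_conj by (rule computable_op_mult)

lemma decidable_op_not:
  assumes "decidable_op k R"
  shows "decidable_op k (\<lambda>p xs. \<not> R p xs)"
proof -
  have "computable_op k (\<lambda>p xs. 1 - of_bool (R p xs))"
    using assms unfolding decidable_op_def by (intro computable_op_diff computable_op_const)
  moreover have "1 - of_bool b = (of_bool (\<not> b) :: nat)" for b by simp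
  ultimately show ?thesis by (simp add: decidable_op_def)
qed

lemma decidable_op_disj:
  assumes "decidable_op k R" "decidable_op k S"
  shows "decidable_op k (\<lambda>p xs. R p xs \<or> S p xs)"
  using decidable_op_not[OF decidable_op_conj[OF assms[THEN decidable_op_not]]] by simp

lemma decidable_op_imp:
  assumes "decidable_op k R" "decidable_op k S"
  shows "decidable_op k (\<lambda>p xs. R p xs \<longrightarrow> S p xs)"
  using decidable_op_disj[OF decidable_op_not[OF assms(1)] assms(2)] by simp

lemma decidable_op_eq:
  fixes F G :: "(nat \<Rightarrow> nat) \<Rightarrow> nat list \<Rightarrow> nat"
  assumes "computable_op k F" "computable_op k G"
  shows "decidable_op k (\<lambda>p xs. F p xs = G p xs)"
proof -
  have eq: "a = b \<longleftrightarrow> a \<le> b \<and> b \<le> a" for a b :: nat by auto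
  show ?thesis
    unfolding eq by (intro decidable_op_conj decidable_op_le assms)
qed

lemma decidable_op_All_less:
  assumes "computable_op k N" "decidable_op (Suc k) (\<lambda>p xs. R p (tl xs) (hd xs))"
  shows "decidable_op k (\<lambda>p xs. \<forall>m<N p xs. R p xs m)"
proof -
  \<comment> \<open>The recursion step receives the counter, the accumulator and then the
    parameters. Projections that skip position 1 hide the accumulator from \<open>R\<close>.\<close>
  have "computable_op (Suc (Suc k)) (\<lambda>p xs. (\<lambda>p xs. of_bool (R p (tl xs) (hd xs))) p
      (map (\<lambda>G. G p xs) ((\<lambda>p xs. xs ! 0) # map (\<lambda>i p xs. xs ! i) [2..<Suc (Suc k)])))"
    using assms(2) unfolding decidable_op_def
    by (intro computable_op_comp) (auto simp del: upt_Suc intro: computable_op_nth)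
  moreover have "map (\<lambda>i. (a # b # xs) ! i) [2..<Suc (Suc k)] = xs"
    if "length xs = k" for a b and xs :: "nat list"
    using that by (intro nth_equalityI) (auto simp: numeral_2_eq_2 simp del: upt_Suc)
  ultimately have H: "computable_op (Suc (Suc k)) (\<lambda>p xs. of_bool (R p (tl (tl xs)) (hd xs)))"
    by (elim computable_op_cong) (auto simp: comp_def length_Suc_conv simp del: upt_Suc)
  \<comment> \<open>A bounded universal quantifier is a product of truth values; the empty product 1
    handles bound 0.\<close>
  have "computable_op k (\<lambda>p xs. rec_nat 1 (\<lambda>m r. r * of_bool (R p xs m)) (N p xs))"
    by (intro computable_op_rec_nat computable_op_mult computable_op_const computable_op_vars assms(1) H)
      simp
  moreover have "rec_nat 1 (\<lambda>m r. r * of_bool (S m)) n = (of_bool (\<forall>m<n. S m) :: nat)" for S n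
    by (induction n) (auto simp: less_Suc_eq)
  ultimately show ?thesis by (simp add: decidable_op_def)
qed

lemma decidable_op_Ex_less:
  assumes "computable_op k N" "decidable_op (Suc k) (\<lambda>p xs. R p (tl xs) (hd xs))"
  shows "decidable_op k (\<lambda>p xs. \<exists>m<N p xs. R p xs m)"
  using decidable_op_not[OF decidable_op_All_less[OF assms(1) decidable_op_not[OF assms(2)]]] by simp

lemma decidable_op_Ex_le:
  assumes "computable_op k N" "decidable_op (Suc k) (\<lambda>p xs. R p (tl xs) (hd xs))"
  shows "decidable_op k (\<lambda>p xs. \<exists>m\<le>N p xs. R p xs m)"
  using decidable_op_Ex_less[OF computable_op_Suc[OF assms(1)] assms(2)] by (simp add: less_Suc_eq_le)

lemmas computable_op_arith =
  computable_op_const computable_op_Suc computable_op_add computable_op_mult computable_op_diff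
  computable_op_power2 computable_op_prod_encode computable_op_oracle computable_op_vars

lemmas decidable_op_logic =
  decidable_op_conj decidable_op_disj decidable_op_not decidable_op_imp decidable_op_eq
  decidable_op_le decidable_op_All_less decidable_op_Ex_less decidable_op_Ex_le

text \<open>Neither component exceeds the code. Hence the partner of a candidate component can be
  sought below the code, and unbounded search for the candidate itself terminates.\<close>

lemma computable_op_prod_decode:
  assumes "computable_op k F"
  shows computable_op_fst_prod_decode: "computable_op k (\<lambda>p xs. fst (prod_decode (F p xs)))"
    and computable_op_snd_prod_decode: "computable_op k (\<lambda>p xs. snd (prod_decode (F p xs)))"
proof -
  have bnd: "snd (prod_decode n) \<le> n" "fst (prod_decode n) \<le> n" for n
    by (metis le_prod_encode_1 le_prod_encode_2 prod.collapse prod_decode_inverse)+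
  have "fst (prod_decode n) = (LEAST a. \<exists>b\<le>n. prod_encode (a, b) = n)" for n
    by (rule Least_equality[symmetric]) (use bnd in \<open>auto intro!: exI[of _ "snd (prod_decode n)"]\<close>)
  moreover have "computable_op 1 (\<lambda>p xs. LEAST a. \<exists>b\<le>hd xs. prod_encode (a, b) = hd xs)"
  proof (rule computable_op_Least)
    show "decidable_op (Suc 1) (\<lambda>p xs. \<exists>b\<le>hd (tl xs). prod_encode (hd xs, b) = hd (tl xs))"
      by (intro decidable_op_logic computable_op_arith) simp_all
    show "\<exists>a. \<exists>b\<le>hd xs. prod_encode (a, b) = hd xs" for xs
      using bnd[of "hd xs"] by (intro exI[of _ "fst (prod_decode (hd xs))"] exI[of _ "snd (prod_decode (hd xs))"]) auto
  qed
  ultimately have "computable_op 1 (\<lambda>p xs. fst (prod_decode (hd xs)))" by simp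
  then show "computable_op k (\<lambda>p xs. fst (prod_decode (F p xs)))"
    using assms by (rule computable_op_subst1)
  have "snd (prod_decode n) = (LEAST b. \<exists>a\<le>n. prod_encode (a, b) = n)" for n
    by (rule Least_equality[symmetric]) (use bnd in \<open>auto intro!: exI[of _ "fst (prod_decode n)"]\<close>)
  moreover have "computable_op 1 (\<lambda>p xs. LEAST b. \<exists>a\<le>hd xs. prod_encode (a, b) = hd xs)"
  proof (rule computable_op_Least)
    show "decidable_op (Suc 1) (\<lambda>p xs. \<exists>a\<le>hd (tl xs). prod_encode (a, hd xs) = hd (tl xs))"
      by (intro decidable_op_logic computable_op_arith) simp_all
    show "\<exists>b. \<exists>a\<le>hd xs. prod_encode (a, b) = hd xs" for xs
      using bnd[of "hd xs"] by (intro exI[of _ "fst (prod_decode (hd xs))"] exI[of _ "snd (prod_decode (hd xs))"]) auto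
  qed
  ultimately have "computable_op 1 (\<lambda>p xs. snd (prod_decode (hd xs)))" by simp
  then show "computable_op k (\<lambda>p xs. snd (prod_decode (F p xs)))"
    using assms by (rule computable_op_subst1)
qed

text \<open>Membership says that a binary digit is 1, that is, that a quotient by a power of 2 is
  odd. Writing quotient and remainder as bounded existentials avoids programming division.\<close>

lemma decidable_op_set_decode:
  assumes "computable_op k F" "computable_op k G"
  shows "decidable_op k (\<lambda>p xs. F p xs \<in> set_decode (G p xs))"
proof -
  have iff: "m \<in> set_decode d \<longleftrightarrow> (\<exists>q\<le>d. \<exists>r<2 ^ m. d = (2 * q + 1) * 2 ^ m + r)" for m d
  proof
    assume "m \<in> set_decode d"
    then obtain q where q: "d div 2 ^ m = 2 * q + 1"
      by (auto simp: set_decode_def elim: oddE)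
    have "q \<le> d div 2 ^ m" using q by simp
    also have "\<dots> \<le> d" by simp
    finally have "q \<le> d" .
    moreover have "d = (2 * q + 1) * 2 ^ m + d mod 2 ^ m"
      using q by (metis div_mult_mod_eq)
    moreover have "d mod 2 ^ m < 2 ^ m" by simp
    ultimately show "\<exists>q\<le>d. \<exists>r<2 ^ m. d = (2 * q + 1) * 2 ^ m + r" by blast
  next
    assume "\<exists>q\<le>d. \<exists>r<2 ^ m. d = (2 * q + 1) * 2 ^ m + r"
    then obtain q r where "r < 2 ^ m" "d = (2 * q + 1) * 2 ^ m + r" by blast
    moreover have "((2 * q + 1) * 2 ^ m + r) div 2 ^ m = (2 * q + 1) + r div 2 ^ m"
      by (rule div_mult_self3) simp
    ultimately have "d div 2 ^ m = 2 * q + 1" by simp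
    then show "m \<in> set_decode d" by (simp add: set_decode_def)
  qed
  have "decidable_op 2 (\<lambda>p xs. \<exists>q\<le>hd (tl xs). \<exists>r<2 ^ hd xs. hd (tl xs) = (2 * q + 1) * 2 ^ hd xs + r)"
    by (intro decidable_op_logic computable_op_arith) simp_all
  then have "decidable_op 2 (\<lambda>p xs. hd xs \<in> set_decode (hd (tl xs)))"
    by (simp only: iff)
  from computable_op_subst2[OF this[unfolded decidable_op_def] assms] show ?thesis
    by (simp add: decidable_op_def)
qed

section \<open>Enumerations\<close>

text \<open>
  \<open>computable_fun\<close> uses the oracle that is constantly zero, so its queries can be answered by \<open>Zero\<close>.
\<close>

primrec without_queries :: "prog \<Rightarrow> prog" where
  "without_queries Zero = Zero"
| "without_queries Succ = Succ"
| "without_queries (Proj i) = Proj i"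
| "without_queries Query = Zero"
| "without_queries (Comp f gs) = Comp (without_queries f) (map without_queries gs)"
| "without_queries (PrimRec g h) = PrimRec (without_queries g) (without_queries h)"
| "without_queries (Mu f) = Mu (without_queries f)"

lemma eval_prog_without_queries:
  "eval_prog (\<lambda>_. 0) e xs y \<Longrightarrow> eval_prog p (without_queries e) xs y"
proof (induction rule: eval_prog.induct)
  case (comp xs gs ys f z)
  have "list_all2 (\<lambda>g y. eval_prog p g xs y) (map without_queries gs) ys"
    using comp.IH(1) unfolding list_all2_map1 by (rule list_all2_mono) blast
  then show ?case using comp.IH(2) by (auto intro: eval_prog.comp)
next
  case (mu f n xs)
  then show ?case by (auto intro!: eval_prog.mu)
qed (auto intro: eval_prog.intros)

lemma enumerated_by_iff: "k \<in> enumerated_by p \<longleftrightarrow> (\<exists>n. p n = Suc k)"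
  by (auto simp: enumerated_by_def image_iff eq_commute)

lemma ce_set_enumerated:
  assumes "ce_set W"
  obtains g where "computable_op 1 (\<lambda>p xs. g (hd xs))" "W = enumerated_by g"
proof (cases "W = {}")
  case True
  then show ?thesis
    \<comment> \<open>The constant 0 enumerates nothing. In the other case all values are shifted by
      one, because 0 is reserved for idle stages.\<close>
    using computable_op_const[of 1 0] by (intro that[of "\<lambda>_. 0"]) (auto simp: enumerated_by_def)
next
  case False
  then obtain f e where f: "W = range f" "transforms e (\<lambda>_. 0) f"
    using assms by (auto simp: ce_set_def computable_fun_def)
  have "computable_op 1 (\<lambda>p xs. f (hd xs))"
  proof (rule computable_opI[where e = "without_queries e"])
    fix p and xs :: "nat list" assume "length xs = 1"
    then have "xs = [hd xs]" by (cases xs) auto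
    then show "eval_prog p (without_queries e) xs (f (hd xs))"
      using f(2) eval_prog_without_queries unfolding transforms_def by metis
  qed
  then show ?thesis
    by (intro that[of "\<lambda>n. Suc (f n)"] computable_op_Suc) (auto simp: enumerated_by_def f(1))
qed

text \<open>Stage \<open>n\<close> tests the pair coded by \<open>n\<close> and outputs either the
  shifted candidate or the idle value 0. Both procedures of the reduction arise this way.\<close>

lemma transforms_enumeration:
  assumes "decidable_op 2 (\<lambda>p xs. D p (hd xs) (hd (tl xs)))"
  obtains e where "\<And>p. \<exists>h. transforms e p h \<and> enumerated_by h = {c. \<exists>w. D p c w}"
proof -
  define h where "h p n = of_bool (D p (fst (prod_decode n)) (snd (prod_decode n)))
    * Suc (fst (prod_decode n))" for p n
  have "computable_op 1 (\<lambda>p xs. of_bool (D p (fst (prod_decode (hd xs))) (snd (prod_decode (hd xs)))))"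
    by (rule computable_op_subst2[OF assms[unfolded decidable_op_def]])
      (intro computable_op_prod_decode computable_op_vars, simp)+
  then have "computable_op 1 (\<lambda>p xs. h p (hd xs))"
    unfolding h_def by (intro computable_op_arith computable_op_prod_decode) simp_all
  then obtain e where e: "\<And>p xs. length xs = 1 \<Longrightarrow> eval_prog p e xs (h p (hd xs))"
    by (rule computable_opE) blast
  show ?thesis
  proof (rule that[of e], rule exI, rule conjI)
    fix p
    show "transforms e p (h p)"
      using e[of "[n]" for n] by (simp add: transforms_def)
    show "enumerated_by (h p) = {c. \<exists>w. D p c w}"
    proof (intro equalityI subsetI)
      fix c assume "c \<in> enumerated_by (h p)"
      then obtain n where "Suc c = h p n" by (auto simp: enumerated_by_def)
      then have "D p c (snd (prod_decode n))"
        by (simp add: h_def of_bool_def split: if_splits)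
      then show "c \<in> {c. \<exists>w. D p c w}" by blast
    next
      fix c assume "c \<in> {c. \<exists>w. D p c w}"
      then obtain w where "D p c w" by blast
      then have "h p (prod_encode (c, w)) = Suc c" by (simp add: h_def)
      then show "c \<in> enumerated_by (h p)"
        by (auto simp: enumerated_by_iff)
    qed
  qed
qed

section \<open>Copies of pairs\<close>

lemma rational_point_in_hilbert_cube: "rational_point c \<in> hilbert_cube"
  by (auto simp: hilbert_cube_def rational_point_def unit_rat_def Let_def split: prod.splits)

lemma openin_ball_union: "openin (top_of_set hilbert_cube) (ball_union e)"
proof -
  have "openin (top_of_set hilbert_cube) (rational_ball n)" for n
  proof -
    obtain c r where cr: "prod_decode n = (c, r)" by fastforce
    have "openin (top_of_set hilbert_cube)
        (hilbert_cube \<inter> dQ (rational_point c) -` {..<pos_rat r})"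
      by (intro continuous_openin_preimage_gen continuous_on_dQ rational_point_in_hilbert_cube) auto
    moreover have "rational_ball n = hilbert_cube \<inter> dQ (rational_point c) -` {..<pos_rat r}"
      by (auto simp: rational_ball_def cr)
    ultimately show ?thesis by simp
  qed
  then show ?thesis unfolding ball_union_def by auto
qed

lemma compacts_Q_diff_ball_union:
  assumes "K \<in> compacts_Q"
  shows "K - ball_union e \<in> compacts_Q"
proof -
  \<comment> \<open>A ball union is open only relative to the cube. Inside \<open>K\<close> it
    removes the same points as an open set \<open>W\<close> of the whole space.\<close>
  obtain W where W: "open W" "ball_union e = hilbert_cube \<inter> W"
    using openin_ball_union by (auto simp: openin_open)
  have "K - ball_union e = K - W" using assms W by (auto simp: compacts_Q_def)
  then show ?thesis using assms W by (auto simp: compacts_Q_def compact_diff)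
qed

lemma is_copy_compacts_Q:
  assumes "compact_pair X A" "is_copy X A Y B"
  shows "Y \<in> compacts_Q" "B \<in> compacts_Q" "B \<subseteq> Y"
proof -
  obtain f where f: "homeomorphic_map X (top_of_set Y) f" "f ` A = B"
    using assms(2) by (auto simp: is_copy_def)
  have X: "compactin X (topspace X)" "compactin X A"
    using assms(1) by (auto simp: compact_pair_def compact_space_def)
  have "f ` topspace X = Y"
    using homeomorphic_imp_surjective_map[OF f(1)] by simp
  moreover have "compactin (top_of_set Y) (f ` K)" if "compactin X K" for K
    using image_compactin[OF that homeomorphic_imp_continuous_map[OF f(1)]] .
  ultimately have "compact Y" "compact B" "B \<subseteq> Y"
    using X f(2) by (auto simp: compactin_subtopology)
  then show "Y \<in> compacts_Q" "B \<in> compacts_Q" "B \<subseteq> Y"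
    using assms(2) by (auto simp: compacts_Q_def is_copy_def)
qed

section \<open>Transfer of invariance and minimality between copies\<close>

lemma is_copy_trans:
  assumes "is_copy X A Y B" "is_copy X A Z C" "A \<subseteq> topspace X"
  shows "is_copy (top_of_set Y) B Z C"
proof -
  obtain f g where f: "homeomorphic_map X (top_of_set Y) f" "f ` A = B"
    and g: "homeomorphic_map X (top_of_set Z) g" "g ` A = C"
    using assms by (auto simp: is_copy_def)
  obtain f' where f': "homeomorphic_maps X (top_of_set Y) f f'"
    using f(1) homeomorphic_map_maps by blast
  have "homeomorphic_map (top_of_set Y) X f'"
    using f' homeomorphic_maps_map by blast
  then have "homeomorphic_map (top_of_set Y) (top_of_set Z) (g \<circ> f')"
    using g(1) by (rule homeomorphic_map_compose)
  moreover have "(g \<circ> f') ` B = C"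
  proof -
    \<comment> \<open>\<open>f'\<close> inverts \<open>f\<close> only on \<open>topspace X\<close>,
      so the inclusion of \<open>A\<close> is essential here.\<close>
    have "f' (f a) = a" if "a \<in> A" for a
      using f' assms(3) that by (auto simp: homeomorphic_maps_def)
    then show ?thesis unfolding f(2)[symmetric] g(2)[symmetric] by (force simp: image_image)
  qed
  ultimately show ?thesis using assms(2) by (auto simp: is_copy_def)
qed

lemma topological_invariant_is_copy:
  assumes "topological_invariant P" "has_property P X A" "compact_pair X A" "is_copy X A Y B"
  shows "(Y, B) \<in> P"
proof -
  obtain Z C where Z: "is_copy X A Z C" "(Z, C) \<in> P"
    using assms(2) by (auto simp: has_property_def)
  \<comment> \<open>Invariance constrains only members of \<open>P\<close> that are genuine
    pairs.\<close>
  have "C \<subseteq> Z" using is_copy_compacts_Q[OF assms(3) Z(1)] by blast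
  moreover have "is_copy (top_of_set Z) C Y B"
    using Z(1) assms(3,4) by (auto simp: compact_pair_def compactin_def intro: is_copy_trans)
  ultimately show ?thesis
    using assms(1) Z(2) by (fastforce simp: topological_invariant_def)
qed

text \<open>Minimality concerns subpairs of the abstract \<open>(X, A)\<close>. Pulling
  \<open>Y'\<close> back along the homeomorphism gives a closed, hence compact, proper subset of
  \<open>X\<close>, and the restricted homeomorphism makes \<open>(Y', B \<inter> Y')\<close> a copy
  of the resulting proper subpair.\<close>

lemma minimal_pair_copy:
  assumes min: "minimal_pair P X A" and cp: "compact_pair X A" and copy: "is_copy X A Y B"
    and Y': "Y' \<in> compacts_Q" "Y' \<subset> Y"
  shows "(Y', B \<inter> Y') \<notin> P"
proof
  assume P: "(Y', B \<inter> Y') \<in> P"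
  obtain f where f: "homeomorphic_map X (top_of_set Y) f" "f ` A = B"
    using copy by (auto simp: is_copy_def)
  have cont: "continuous_map X (top_of_set Y) f"
    using f(1) by (rule homeomorphic_imp_continuous_map)
  have surj: "f ` topspace X = Y"
    using homeomorphic_imp_surjective_map[OF f(1)] by simp
  define X' where "X' = {x \<in> topspace X. f x \<in> Y'}"
  have A: "compactin X A" and X: "compact_space X" using cp by (auto simp: compact_pair_def)
  have AX: "A \<subseteq> topspace X" using A by (rule compactin_subset_topspace)
  have "closedin (top_of_set Y) Y'"
    using Y' by (intro closed_subset compact_imp_closed) (auto simp: compacts_Q_def)
  then have closed: "closedin X X'"
    unfolding X'_def by (rule closedin_continuous_map_preimage[OF cont])
  have "compactin X X'" using closed X by (rule closedin_compact_space[rotated])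
  moreover have "compactin X (A \<inter> X')" using A closed by (simp add: compact_Int_closedin)
  moreover have "X' \<subset> topspace X" using Y'(2) surj by (auto simp: X'_def)
  ultimately have "proper_subpair X A X' (A \<inter> X')" by (auto simp: proper_subpair_def)
  then have "\<not> has_property P (subtopology X X') (A \<inter> X')"
    using min by (simp add: minimal_pair_def)
  moreover have "is_copy (subtopology X X') (A \<inter> X') Y' (B \<inter> Y')"
  proof -
    have "homeomorphic_map (subtopology X X') (subtopology (top_of_set Y) Y') f"
      using surj Y'(2) by (intro homeomorphic_map_subtopologies[OF f(1)]) (auto simp: X'_def)
    moreover have "subtopology (top_of_set Y) Y' = top_of_set Y'"
      using Y'(2) by (simp add: subtopology_subtopology inf.absorb2 psubset_imp_subset)
    moreover have "f ` (A \<inter> X') = B \<inter> Y'"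
      using f(2) AX by (auto simp: X'_def)
    ultimately show ?thesis using Y'(1) by (auto simp: is_copy_def compacts_Q_def)
  qed
  ultimately show False using P by (auto simp: has_property_def)
qed

text \<open>\<open>W\<close> presents the sequence \<open>A\<^sub>n\<close>. In the application,
  \<open>WP\<close> combines two facts about subpairs of \<open>(Y, B)\<close>: the unrefuted ones
  lie in \<open>A\<^sub>n\<close>, and none lies in \<open>B\<^sub>n\<close>. \<open>WY\<close>
  expresses that \<open>(Y, B)\<close> itself is in \<open>A\<^sub>n\<close>.\<close>

lemma meets_iff_refuted:
  assumes min: "minimal_pair P X A"
    and cp: "compact_pair X A" and copy: "is_copy X A Y B"
    and WP: "\<And>K L. (K, L) \<in> compacts_Q \<times> compacts_Q \<Longrightarrow> K \<subseteq> Y \<Longrightarrow> L \<subseteq> B \<Longrightarrow>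
      (\<And>i j. prod_encode (n, prod_encode (i, j)) \<in> W \<Longrightarrow> \<not> (K \<subseteq> ball_union i \<and> L \<subseteq> ball_union j)) \<Longrightarrow>
      (K, L) \<in> P"
    and WY: "\<And>i j. prod_encode (n, prod_encode (i, j)) \<in> W \<Longrightarrow> \<not> (Y \<subseteq> ball_union i \<and> B \<subseteq> ball_union j)"
  shows "Y \<inter> ball_union e \<noteq> {} \<longleftrightarrow>
    (\<exists>i j. prod_encode (n, prod_encode (i, j)) \<in> W \<and>
      Y \<subseteq> ball_union e \<union> ball_union i \<and> B \<subseteq> ball_union e \<union> ball_union j)"
proof
  note Y = is_copy_compacts_Q[OF cp copy]
  assume ne: "Y \<inter> ball_union e \<noteq> {}"
  have "(Y - ball_union e, B \<inter> (Y - ball_union e)) \<notin> P"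
    using ne by (intro minimal_pair_copy[OF min cp copy] compacts_Q_diff_ball_union Y) auto
  moreover have "B \<inter> (Y - ball_union e) = B - ball_union e" using Y(3) by auto
  ultimately have "(Y - ball_union e, B - ball_union e) \<notin> P" by simp
  then obtain i j where "prod_encode (n, prod_encode (i, j)) \<in> W"
      "Y - ball_union e \<subseteq> ball_union i" "B - ball_union e \<subseteq> ball_union j"
    using WP[of "Y - ball_union e" "B - ball_union e"] compacts_Q_diff_ball_union Y by blast
  then show "\<exists>i j. prod_encode (n, prod_encode (i, j)) \<in> W \<and>
      Y \<subseteq> ball_union e \<union> ball_union i \<and> B \<subseteq> ball_union e \<union> ball_union j" by blast
next
  assume "\<exists>i j. prod_encode (n, prod_encode (i, j)) \<in> W \<and>
      Y \<subseteq> ball_union e \<union> ball_union i \<and> B \<subseteq> ball_union e \<union> ball_union j"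
  \<comment> \<open>If \<open>Y\<close> missed the union \<open>e\<close>, so would
    \<open>B\<close>; dropping \<open>e\<close> from both coverings would then refute
    \<open>(Y, B)\<close>.\<close>
  then show "Y \<inter> ball_union e \<noteq> {}"
    using WY is_copy_compacts_Q(3)[OF cp copy] by blast
qed

section \<open>The reduction\<close>

abbreviation pr1 :: "nat \<Rightarrow> nat" where "pr1 n \<equiv> fst (prod_decode n)"
abbreviation pr2 :: "nat \<Rightarrow> nat" where "pr2 n \<equiv> snd (prod_decode n)"

text \<open>
  Here \<open>g\<close> enumerates the set that presents a uniformly \<open>\<Pi>\<^sup>0\<^sub>1\<close> sequence, and \<open>p\<close> is a name of a point:
  stages \<open>s\<close> and \<open>t\<close> exhibit a basic neighborhood of the point that misses the \<open>n\<close>-th set.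
\<close>

definition refutes :: "(nat \<Rightarrow> nat) \<Rightarrow> nat \<Rightarrow> (nat \<Rightarrow> nat) \<Rightarrow> nat \<Rightarrow> nat \<Rightarrow> bool" where
  "refutes g n p s t \<longleftrightarrow> p t \<noteq> 0 \<and> g s = Suc (prod_encode (n, p t - 1))"

text \<open>
  A name of \<open>(Y, B)\<close> lists the indices of all basic neighborhoods, so the index of a union
  need not be computed: it suffices to recognize a listed index that is covered by the union.
\<close>

definition covered :: "nat \<Rightarrow> nat \<Rightarrow> nat \<Rightarrow> bool" where
  "covered d e i \<longleftrightarrow> (\<forall>m<d. m \<in> set_decode d \<longrightarrow> m \<in> set_decode e \<or> m \<in> set_decode i)"

text \<open>A finite certificate for the right-hand side of \<open>meets_iff_refuted\<close>: stage
  \<open>s\<close> of \<open>g\<close> supplies the excluded neighborhood, stage \<open>t\<close> of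
  \<open>p\<close> a neighborhood of \<open>(Y, B)\<close> that proves the two coverings.
  Subtracting 1 undoes the shift of \<open>enumerated_by\<close>.\<close>

definition meets_witness :: "(nat \<Rightarrow> nat) \<Rightarrow> nat \<Rightarrow> (nat \<Rightarrow> nat) \<Rightarrow> nat \<Rightarrow> nat \<Rightarrow> nat \<Rightarrow> bool" where
  "meets_witness g n p e s t \<longleftrightarrow> p t \<noteq> 0 \<and> g s \<noteq> 0 \<and> pr1 (g s - 1) = n \<and>
    covered (pr1 (p t - 1)) e (pr1 (pr2 (g s - 1))) \<and>
    covered (pr2 (p t - 1)) e (pr2 (pr2 (g s - 1)))"

text \<open>The two cases are those of \<open>sum_decode\<close>.\<close>

definition subbasic_witness :: "(nat \<Rightarrow> nat) \<Rightarrow> nat \<Rightarrow> (nat \<Rightarrow> nat) \<Rightarrow> nat \<Rightarrow> nat \<Rightarrow> bool" where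
  "subbasic_witness g n p m w \<longleftrightarrow>
    (\<exists>e\<le>m. m = 2 * e \<and> p w = Suc (prod_encode (e, e)) \<or>
      m = 2 * e + 1 \<and> meets_witness g n p e (pr1 w) (pr2 w))"

text \<open>One number \<open>w\<close> bounds the witnesses of all subbasic conditions, so no list
  of witnesses needs to be coded.\<close>

definition basic_witness :: "(nat \<Rightarrow> nat) \<Rightarrow> nat \<Rightarrow> (nat \<Rightarrow> nat) \<Rightarrow> nat \<Rightarrow> nat \<Rightarrow> bool" where
  "basic_witness g n p c w \<longleftrightarrow> (\<forall>m<c. m \<in> set_decode c \<longrightarrow> (\<exists>v\<le>w. subbasic_witness g n p m v))"

section \<open>Correctness of the witnesses\<close>

text \<open>Ensures that the bounded quantifiers in \<open>covered\<close> and
  \<open>basic_witness\<close> reach every member.\<close>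

lemma set_decode_less:
  assumes "m \<in> set_decode d"
  shows "m < d"
proof -
  have "d div 2 ^ m \<noteq> 0" using assms by (auto simp: set_decode_def intro: ccontr)
  then have "2 ^ m \<le> d" by (simp add: div_eq_0_iff)
  then show ?thesis using less_exp[of m] by linarith
qed

lemma covered_iff: "covered d e i \<longleftrightarrow> set_decode d \<subseteq> set_decode e \<union> set_decode i"
  using set_decode_less by (auto simp: covered_def)

lemma basic_witness_iff:
  "(\<exists>w. basic_witness g n p c w) \<longleftrightarrow> (\<forall>m\<in>set_decode c. \<exists>w. subbasic_witness g n p m w)"
proof
  assume "\<forall>m\<in>set_decode c. \<exists>w. subbasic_witness g n p m w"
  then obtain f where f: "\<forall>m\<in>set_decode c. subbasic_witness g n p m (f m)" by (auto dest: bchoice)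
  \<comment> \<open>The decoded set is finite. If it is empty, \<open>Max\<close> is unspecified,
    but there is then no condition to meet.\<close>
  have "f m \<le> Max (f ` set_decode c)" if "m \<in> set_decode c" for m
    using that by (intro Max_ge) auto
  then have "basic_witness g n p c (Max (f ` set_decode c))"
    unfolding basic_witness_def using f by blast
  then show "\<exists>w. basic_witness g n p c w" ..
qed (use set_decode_less in \<open>unfold basic_witness_def, blast\<close>)

lemma refutes_iff:
  "(\<exists>s t. refutes g n p s t) \<longleftrightarrow> (\<exists>k\<in>enumerated_by p. prod_encode (n, k) \<in> enumerated_by g)"
proof
  assume "\<exists>s t. refutes g n p s t"
  then obtain s t where st: "p t \<noteq> 0" "g s = Suc (prod_encode (n, p t - 1))" by (auto simp: refutes_def)
  then have "Suc (p t - 1) = p t" by simp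
  then have "p t - 1 \<in> enumerated_by p" unfolding enumerated_by_iff by metis
  moreover have "prod_encode (n, p t - 1) \<in> enumerated_by g"
    using st(2) unfolding enumerated_by_iff by metis
  ultimately show "\<exists>k\<in>enumerated_by p. prod_encode (n, k) \<in> enumerated_by g" by blast
next
  assume "\<exists>k\<in>enumerated_by p. prod_encode (n, k) \<in> enumerated_by g"
  then obtain k s t where "p t = Suc k" "g s = Suc (prod_encode (n, k))"
    by (auto simp: enumerated_by_iff)
  then have "refutes g n p s t" by (simp add: refutes_def)
  then show "\<exists>s t. refutes g n p s t" by blast
qed

lemma meets_witness_iff:
  assumes p: "enumerated_by p = {k. Y \<subseteq> ball_union (pr1 k) \<and> B \<subseteq> ball_union (pr2 k)}"
  shows "(\<exists>s t. meets_witness g n p e s t) \<longleftrightarrow>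
    (\<exists>i j. prod_encode (n, prod_encode (i, j)) \<in> enumerated_by g \<and>
      Y \<subseteq> ball_union e \<union> ball_union i \<and> B \<subseteq> ball_union e \<union> ball_union j)"
proof
  assume "\<exists>s t. meets_witness g n p e s t"
  then obtain s t where "meets_witness g n p e s t" by blast
  then obtain k x where k: "p t = Suc k" and x: "g s = Suc x" "pr1 x = n"
    and cov: "covered (pr1 k) e (pr1 (pr2 x))" "covered (pr2 k) e (pr2 (pr2 x))"
    by (cases "p t"; cases "g s") (auto simp: meets_witness_def)
  have "k \<in> enumerated_by p" using k unfolding enumerated_by_iff by metis
  then have "Y \<subseteq> ball_union (pr1 k)" "B \<subseteq> ball_union (pr2 k)" using p by auto
  moreover have "ball_union d \<subseteq> ball_union e \<union> ball_union i" if "covered d e i" for d i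
    using that unfolding covered_iff ball_union_def by blast
  ultimately have "Y \<subseteq> ball_union e \<union> ball_union (pr1 (pr2 x))"
      "B \<subseteq> ball_union e \<union> ball_union (pr2 (pr2 x))"
    using cov by blast+
  moreover have "prod_encode (n, prod_encode (pr1 (pr2 x), pr2 (pr2 x))) = x"
    using x(2) by (metis prod.collapse prod_decode_inverse)
  then have "prod_encode (n, prod_encode (pr1 (pr2 x), pr2 (pr2 x))) \<in> enumerated_by g"
    using x(1) unfolding enumerated_by_iff by metis
  ultimately show "\<exists>i j. prod_encode (n, prod_encode (i, j)) \<in> enumerated_by g \<and>
      Y \<subseteq> ball_union e \<union> ball_union i \<and> B \<subseteq> ball_union e \<union> ball_union j" by blast
next
  assume "\<exists>i j. prod_encode (n, prod_encode (i, j)) \<in> enumerated_by g \<and>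
      Y \<subseteq> ball_union e \<union> ball_union i \<and> B \<subseteq> ball_union e \<union> ball_union j"
  then obtain i j where ij: "prod_encode (n, prod_encode (i, j)) \<in> enumerated_by g"
      "Y \<subseteq> ball_union e \<union> ball_union i" "B \<subseteq> ball_union e \<union> ball_union j" by blast
  \<comment> \<open>The index of the exact union. A name lists every neighborhood of its point, so
    the pair of these indices shows up at some stage \<open>t\<close>.\<close>
  define d where "d i = set_encode (set_decode e \<union> set_decode i)" for i
  have d: "set_decode (d i) = set_decode e \<union> set_decode i" for i
    by (simp add: d_def)
  then have bu: "ball_union (d i) = ball_union e \<union> ball_union i" for i
    by (auto simp: ball_union_def)
  have "prod_encode (d i, d j) \<in> enumerated_by p"
    using ij(2,3) by (simp add: p bu)
  then obtain t where t: "p t = Suc (prod_encode (d i, d j))" by (auto simp: enumerated_by_iff)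
  obtain s where s: "g s = Suc (prod_encode (n, prod_encode (i, j)))"
    using ij(1) by (auto simp: enumerated_by_iff)
  have "meets_witness g n p e s t"
    by (simp add: meets_witness_def s t covered_iff d)
  then show "\<exists>s t. meets_witness g n p e s t" by blast
qed

lemma subbasic_witness_iff:
  assumes Y: "Y \<in> compacts_Q" "B \<subseteq> Y"
    and p: "enumerated_by p = {k. Y \<subseteq> ball_union (pr1 k) \<and> B \<subseteq> ball_union (pr2 k)}"
    and meets: "\<And>e. Y \<inter> ball_union e \<noteq> {} \<longleftrightarrow> (\<exists>s t. meets_witness g n p e s t)"
  shows "(\<exists>w. subbasic_witness g n p m w) \<longleftrightarrow> Y \<in> vietoris_subbasic m"
proof (cases "even m")
  case True
  then obtain e where m: "m = 2 * e" by blast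
  have "sum_decode m = Inl e" by (simp add: m sum_decode_def)
  then have "Y \<in> vietoris_subbasic m \<longleftrightarrow> Y \<subseteq> ball_union e" using Y by (simp add: vietoris_subbasic_def)
  \<comment> \<open>A name speaks about \<open>Y\<close> and \<open>B\<close> jointly. Since
    \<open>B \<subseteq> Y\<close>, using \<open>e\<close> for both components imposes no condition
    beyond the one on \<open>Y\<close>.\<close>
  also have "\<dots> \<longleftrightarrow> prod_encode (e, e) \<in> enumerated_by p" using Y(2) by (auto simp: p)
  also have "\<dots> \<longleftrightarrow> (\<exists>w. p w = Suc (prod_encode (e, e)))"
    by (simp add: enumerated_by_iff)
  also have "\<dots> \<longleftrightarrow> (\<exists>w. subbasic_witness g n p m w)"
    proof -
    have "2 * e = 2 * e' \<longleftrightarrow> e = e'" "2 * e = 2 * e' + 1 \<longleftrightarrow> False" for e' by presburger+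
    then show ?thesis unfolding subbasic_witness_def m by auto
  qed
  finally show ?thesis by simp
next
  case False
  then obtain e where m: "m = 2 * e + 1" by (elim oddE)
  have "sum_decode m = Inr e" by (simp add: m sum_decode_def)
  then have "Y \<in> vietoris_subbasic m \<longleftrightarrow> (\<exists>s t. meets_witness g n p e s t)"
    using Y meets by (simp add: vietoris_subbasic_def)
  also have "\<dots> \<longleftrightarrow> (\<exists>w. meets_witness g n p e (pr1 w) (pr2 w))"
    by (metis fst_conv prod_encode_inverse snd_conv)
  also have "\<dots> \<longleftrightarrow> (\<exists>w. subbasic_witness g n p m w)"
  proof -
    have "2 * e + 1 = 2 * e' \<longleftrightarrow> False" "2 * e + 1 = 2 * e' + 1 \<longleftrightarrow> e = e'" for e' by presburger+
    then show ?thesis unfolding subbasic_witness_def m by auto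
  qed
  finally show ?thesis by simp
qed

theorem theorem5p17:
  fixes P :: "((nat \<Rightarrow> real) set \<times> (nat \<Rightarrow> real) set) set"
    and X :: "'a topology" and A :: "'a set"
  assumes "topological_invariant P"
    and "Sigma02 (prod_space upper_vietoris upper_vietoris) P"
    and "compact_pair X A"
    and "minimal_pair P X A"
  shows "SCT X A \<le>\<^sub>W closed_choice_nat"
proof -
  let ?S = "prod_space upper_vietoris upper_vietoris"
  have S_points: "points ?S = compacts_Q \<times> compacts_Q"
    by (simp add: prod_space_def upper_vietoris_def)
  have S_basic: "(K, L) \<in> basic ?S k \<longleftrightarrow> K \<in> compacts_Q \<and> L \<in> compacts_Q \<and>
      K \<subseteq> ball_union (pr1 k) \<and> L \<subseteq> ball_union (pr2 k)" for K L k
    by (auto simp: prod_space_def upper_vietoris_def split: prod.splits)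
  obtain PA PB where PA: "uniformly_Pi01 ?S PA" and PB: "uniformly_Pi01 ?S PB"
    and P: "P = (\<Union>n. PA n - PB n)"
    using assms(2) unfolding Sigma02_def by blast
  \<comment> \<open>The enumerations \<open>a\<close> and \<open>b\<close> of the excluded
    neighborhoods are computable under any oracle, so they can be built into programs that query
    \<open>p\<close>.\<close>
  obtain a where a1: "computable_op 1 (\<lambda>p xs. a (hd xs))"
    and PA_eq: "\<And>n. PA n = points ?S - (\<Union>k\<in>{k. prod_encode (n, k) \<in> enumerated_by a}. basic ?S k)"
    using PA unfolding uniformly_Pi01_def by (metis ce_set_enumerated)
  obtain b where b1: "computable_op 1 (\<lambda>p xs. b (hd xs))"
    and PB_eq: "\<And>n. PB n = points ?S - (\<Union>k\<in>{k. prod_encode (n, k) \<in> enumerated_by b}. basic ?S k)"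
    using PB unfolding uniformly_Pi01_def by (metis ce_set_enumerated)
  note a = computable_op_subst1[where f = "\<lambda>_. a", OF a1]
  note b = computable_op_subst1[where f = "\<lambda>_. b", OF b1]
  note intros = decidable_op_logic decidable_op_set_decode computable_op_arith computable_op_prod_decode a b

  \<comment> \<open>A solution codes \<open>(n, (s, t))\<close> where \<open>s\<close> and \<open>t\<close> refute membership in \<open>PB n\<close> and nothing refutes
    membership in \<open>PA n\<close>.\<close>
  define nonsolution where "nonsolution p u w \<longleftrightarrow>
    \<not> refutes b (pr1 u) p (pr1 (pr2 u)) (pr2 (pr2 u)) \<or> refutes a (pr1 u) p (pr1 w) (pr2 w)" for p u w
  have "decidable_op 2 (\<lambda>p xs. nonsolution p (hd xs) (hd (tl xs)))"
    unfolding nonsolution_def refutes_def by (intro intros) simp_all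
  \<comment> \<open>The stages refuting \<open>PB n\<close> are fixed by \<open>u\<close>, so only
    the search for a refutation of \<open>PA n\<close> is unbounded. Nonsolutions are thus
    enumerable from \<open>p\<close>, as an instance of closed choice requires.\<close>
  then obtain eK where eK: "\<And>p. \<exists>k. transforms eK p k \<and> enumerated_by k = {u. \<exists>w. nonsolution p u w}"
    by (rule transforms_enumeration) blast

  \<comment> \<open>Here \<open>r\<close> stands for \<open>join p q\<close>: \<open>r 1\<close> is
    \<open>q 0\<close>, the chosen solution, with first component \<open>n\<close>, and the even
    positions carry \<open>p\<close>.\<close>
  have "decidable_op 2 (\<lambda>r xs. basic_witness a (pr1 (r 1)) (\<lambda>n. r (2 * n)) (hd xs) (hd (tl xs)))"
    unfolding basic_witness_def subbasic_witness_def meets_witness_def covered_def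
    by (intro intros) simp_all
  then obtain eH where eH: "\<And>r. \<exists>h. transforms eH r h \<and>
      enumerated_by h = {c. \<exists>w. basic_witness a (pr1 (r 1)) (\<lambda>n. r (2 * n)) c w}"
    by (rule transforms_enumeration) blast

  show ?thesis
    unfolding weihrauch_reducible_def
  proof (rule exI[of _ eK], rule exI[of _ eH], intro allI impI)
    fix p and x :: "(nat \<Rightarrow> real) set \<times> (nat \<Rightarrow> real) set"
    assume dom: "dom_names (SCT X A) p x"
    obtain Y B where x: "x = (Y, B)" by fastforce
    have copy: "is_copy X A Y B" and name: "point_name ?S p (Y, B)"
      using dom by (auto simp: dom_names_def SCT_def x split: if_splits)
    note Y = is_copy_compacts_Q[OF assms(3) copy]
    have p: "enumerated_by p = {k. Y \<subseteq> ball_union (pr1 k) \<and> B \<subseteq> ball_union (pr2 k)}"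
      using name Y by (simp add: point_name_def S_basic)
    define E where "E = {u. \<not> (\<exists>w. nonsolution p u w)}"
    have E: "u \<in> E \<longleftrightarrow> refutes b (pr1 u) p (pr1 (pr2 u)) (pr2 (pr2 u)) \<and>
        \<not> (\<exists>s t. refutes a (pr1 u) p s t)" for u
      unfolding E_def nonsolution_def by (auto, metis fst_conv prod_encode_inverse snd_conv)
    obtain k where k: "transforms eK p k" "enumerated_by k = - E"
      using eK[of p] unfolding E_def Collect_neg_eq double_complement by blast
    have PA_iff: "(Y, B) \<in> PA n \<longleftrightarrow> \<not> (\<exists>s t. refutes a n p s t)" for n
      using Y by (auto simp: refutes_iff PA_eq S_points S_basic p)
    have PB_iff: "(Y, B) \<in> PB n \<longleftrightarrow> \<not> (\<exists>s t. refutes b n p s t)" for n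
      using Y by (auto simp: refutes_iff PB_eq S_points S_basic p)

    \<comment> \<open>Membership in \<open>P\<close> supplies an \<open>n\<close> and refuting
      stages, so the instance \<open>E\<close> is nonempty and lies in the domain of closed
      choice.\<close>
    have "(Y, B) \<in> P"
      using assms(4) by (intro topological_invariant_is_copy[OF assms(1) _ assms(3) copy])
        (simp add: minimal_pair_def)
    then obtain n where "(Y, B) \<in> PA n" "(Y, B) \<notin> PB n" using P by auto
    then obtain s t where "refutes b n p s t" "\<not> (\<exists>s t. refutes a n p s t)"
      by (auto simp: PA_iff PB_iff)
    then have "prod_encode (n, prod_encode (s, t)) \<in> E" by (simp add: E)
    then have domE: "dom_names closed_choice_nat k E"
      using k(2) by (auto simp: dom_names_def closed_choice_nat_def)

    have "\<exists>h y. transforms eH (join p q) h \<and> sol_name (SCT X A) h y \<and> y \<in> solutions (SCT X A) x"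
      if "u \<in> E" "q 0 = u" for q u
    proof -
      define n where "n = pr1 u"
      have "(Y, B) \<in> PA n" and "(Y, B) \<notin> PB n"
        using that(1) by (auto simp: E PA_iff PB_iff n_def)
      have meets: "Y \<inter> ball_union e \<noteq> {} \<longleftrightarrow> (\<exists>s t. meets_witness a n p e s t)" for e
        unfolding meets_witness_iff[OF p]
      proof (rule meets_iff_refuted[OF assms(4,3) copy])
        fix K L assume KL: "(K, L) \<in> compacts_Q \<times> compacts_Q" "K \<subseteq> Y" "L \<subseteq> B"
          and *: "\<And>i j. prod_encode (n, prod_encode (i, j)) \<in> enumerated_by a \<Longrightarrow>
            \<not> (K \<subseteq> ball_union i \<and> L \<subseteq> ball_union j)"
        have "(K, L) \<in> PA n"
          using KL(1) *[of "pr1 k" "pr2 k" for k] by (auto simp: PA_eq S_points S_basic)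
        \<comment> \<open>The basic neighborhood that excludes \<open>(Y, B)\<close> from
          \<open>PB n\<close> also contains the smaller pair \<open>(K, L)\<close>.\<close>
        moreover have "(K, L) \<notin> PB n"
          using KL Y(1,2) \<open>(Y, B) \<notin> PB n\<close> by (fastforce simp: PB_eq S_points S_basic)
        ultimately show "(K, L) \<in> P" using P by auto
      next
        fix i j assume "prod_encode (n, prod_encode (i, j)) \<in> enumerated_by a"
        then show "\<not> (Y \<subseteq> ball_union i \<and> B \<subseteq> ball_union j)"
          using \<open>(Y, B) \<in> PA n\<close> Y(1,2) S_basic[of Y B "prod_encode (i, j)"] by (auto simp: PA_eq)
      qed
      obtain h where h: "transforms eH (join p q) h"
          "enumerated_by h = {c. \<exists>w. basic_witness a (pr1 (join p q 1)) (\<lambda>n. join p q (2 * n)) c w}"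
        using eH by blast
      have "join p q 1 = u" "(\<lambda>n. join p q (2 * n)) = p"
        using that(2) by (auto simp: join_def)
      \<comment> \<open>By \<open>meets\<close> the certificates found by \<open>eH\<close> are
        exact, so \<open>h\<close> lists precisely the basic Vietoris neighborhoods of
        \<open>Y\<close>.\<close>
      then have "enumerated_by h = {c. \<forall>m\<in>set_decode c. Y \<in> vietoris_subbasic m}"
        by (simp add: h(2) basic_witness_iff subbasic_witness_iff[OF Y(1,3) p meets] flip: n_def)
      then have "point_name vietoris h Y"
        using Y(1) by (simp add: point_name_def vietoris_def)
      then show ?thesis
        using h(1) copy by (auto simp: SCT_def x)
    qed
    then show "\<exists>k u. transforms eK p k \<and> dom_names closed_choice_nat k u \<and>
        (\<forall>q v. v \<in> solutions closed_choice_nat u \<and> sol_name closed_choice_nat q v \<longrightarrow>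
          (\<exists>h y. transforms eH (join p q) h \<and> sol_name (SCT X A) h y \<and> y \<in> solutions (SCT X A) x))"
      using k(1) domE by (intro exI[of _ k] exI[of _ E]) (simp add: closed_choice_nat_def)
  qed
qed

end
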